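(* Let $V$ be a finite-dimensional real vector space equipped with a norm $\|\cdot\|$, with dual space $V^*$ and dual norm $\|\cdot\|_*$. Suppose $K\subseteq V$ is a non-empty bounded closed convex subset. Suppose that $f:K\to\mathbb{R}$ is a non-negative lower semi-continuous function that is $1$-strongly convex with respect to $\|\cdot\|$. Then the SOLO FTRL algorithm with regularizer $$R(w)=\frac{f(w)\sqrt{2.75}}{\sqrt{\sup_{v\in K}f(v)}}$$ satisfies, after $T$ rounds on any sequence of loss vectors $\ell_1,\ell_2,\dots,\ell_T\in V^*$, $$\mathrm{Regret}_T\le13.3\sqrt{\sup_{v\in K}f(v)\;\sum_{t=1}^T\|\ell_t\|_*^2}.$$
   Context: Online linear optimization: in each round $t=1,2,\dots$ an algorithm chooses $w_t\in K$ and then observes a loss vector $\ell_t\in V^*$. The regret is $\mathrm{Regret}_T=\sup_{u\in K}\left(\sum_{t=1}^T\langle \ell_t,w_t\rangle-\sum_{t=1}^T\langle \ell_t,u\rangle\right)$, where $\langle\cdot,\cdot\rangle:V^*\times V\to\mathbb{R}$ is the bilinear pairing of $V^*$ and $V$. Strong convexity: for $\lambda>0$, a function $f:K\to\mathbb{R}$ is $\lambda$-strongly convex with respect to $\|\cdot\|$ if and only if, for all $x,y\in K$, $f(y)\ge f(x)+\langle\nabla f(x),y-x\rangle+\frac{\lambda}{2}\|x-y\|^2$, where $\nabla f(x)$ is any subgradient of $f$ at $x$. SOLO FTRL with a strongly convex regularizer $R:K\to\mathbb{R}$ is Follow The Regularized Leader with the varying regularizers $R_t(w)=R(w)\sqrt{\sum_{s=1}^{t-1}\|\ell_s\|_*^2}$: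 let $L_0=0$ and $L_t=L_{t-1}+\ell_t$; in round $t$ the algorithm predicts $$w_t=\arg\min_{w\in K}\left(\langle L_{t-1},w\rangle+R_t(w)\right).$$ *)

theory Defs
  imports "HOL-Analysis.Analysis"
begin

text \<open>
  The normed space \<open>V\<close> is a type of class \<open>real_normed_vector\<close>, so that its norm is an
  arbitrary one. The dual space is \<open>'a \<Rightarrow>\<^sub>L real\<close>: in finite dimension every linear
  functional is bounded, and \<open>norm\<close> on this type is the operator norm, i.e. the dual norm.
  A function \<open>K \<rightarrow> \<real>\<close> is a function on the whole type of which only the values
  on \<open>K\<close> are ever used.
\<close>

definition finite_dimensional :: "'a::real_normed_vector itself \<Rightarrow> bool" where
  "finite_dimensional _ \<longleftrightarrow> (\<exists>B::'a set. finite B \<and> span B = UNIV)"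

definition lower_semicontinuous_on ::
    "'a::topological_space set \<Rightarrow> ('a \<Rightarrow> real) \<Rightarrow> bool" where
  "lower_semicontinuous_on K f \<longleftrightarrow>
     (\<forall>x\<in>K. \<forall>a<f x. eventually (\<lambda>y. a < f y) (at x within K))"

definition subdifferential ::
    "'a::real_normed_vector set \<Rightarrow> ('a \<Rightarrow> real) \<Rightarrow> 'a \<Rightarrow> ('a \<Rightarrow>\<^sub>L real) set" where
  "subdifferential K f x = {g. \<forall>y\<in>K. f y \<ge> f x + blinfun_apply g (y - x)}"

text \<open>
  At points without any subgradient the condition is vacuous.
\<close>

definition strongly_convex_on ::
    "real \<Rightarrow> 'a::real_normed_vector set \<Rightarrow> ('a \<Rightarrow> real) \<Rightarrow> bool" where
  "strongly_convex_on \<mu> K f \<longleftrightarrow>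
     (\<forall>x\<in>K. \<forall>y\<in>K. \<forall>g\<in>subdifferential K f x.
        f y \<ge> f x + blinfun_apply g (y - x) + \<mu> / 2 * (norm (x - y))\<^sup>2)"

text \<open>
  Rounds are numbered from 1. The minimizer need not be unique (in round 1, for instance, the
  objective is constantly 0), so the algorithm is a predicate on the sequence of predictions
  that admits every choice among the minimizers.
\<close>

definition ftrl ::
    "'a::real_normed_vector set \<Rightarrow> (nat \<Rightarrow> 'a \<Rightarrow> real) \<Rightarrow> (nat \<Rightarrow> 'a \<Rightarrow>\<^sub>L real) \<Rightarrow> nat \<Rightarrow> (nat \<Rightarrow> 'a) \<Rightarrow> bool"
  where
  "ftrl K Rt l T w \<longleftrightarrow>
     (\<forall>t\<in>{1..T}. is_arg_min (\<lambda>u. blinfun_apply (\<Sum>s=1..<t. l s) u + Rt t u) (\<lambda>u. u \<in> K) (w t))"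

definition solo_ftrl ::
    "'a::real_normed_vector set \<Rightarrow> ('a \<Rightarrow> real) \<Rightarrow> (nat \<Rightarrow> 'a \<Rightarrow>\<^sub>L real) \<Rightarrow> nat \<Rightarrow> (nat \<Rightarrow> 'a) \<Rightarrow> bool"
  where
  "solo_ftrl K R l T w \<longleftrightarrow> ftrl K (\<lambda>t u. R u * sqrt (\<Sum>s=1..<t. (norm (l s))\<^sup>2)) l T w"

text \<open>
  The supremum is taken in the reals; it is a genuine one when \<open>K\<close> is non-empty and bounded.
\<close>

definition regret ::
    "'a::real_normed_vector set \<Rightarrow> (nat \<Rightarrow> 'a \<Rightarrow>\<^sub>L real) \<Rightarrow> (nat \<Rightarrow> 'a) \<Rightarrow> nat \<Rightarrow> real" where
  "regret K l w T =
     (SUP u\<in>K. (\<Sum>t=1..T. blinfun_apply (l t) (w t)) - (\<Sum>t=1..T. blinfun_apply (l t) u))"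

text \<open>
  A real-valued lower semi-continuous strongly convex function on a compact convex set may be
  unbounded above (e.g. on a disc), so \<open>sup f\<close> is taken in the extended reals, and the square
  root is extended by \<open>\<surd>\<infinity> = \<infinity>\<close>. The division below is that of
  \<^typ>\<open>ereal\<close>: \<open>x / \<infinity> = 0\<close>, and \<open>0 / 0 = 0\<close> in the degenerate case \<open>sup f = 0\<close>,
  in which \<open>f\<close> vanishes on \<open>K\<close>.
\<close>

definition esqrt :: "ereal \<Rightarrow> ereal" where
  "esqrt x = (if x = \<infinity> then \<infinity> else ereal (sqrt (real_of_ereal x)))"

definition sup_on :: "'a set \<Rightarrow> ('a \<Rightarrow> real) \<Rightarrow> ereal" where
  "sup_on K f = (SUP v\<in>K. ereal (f v))"

definition scaled_regularizer :: "'a set \<Rightarrow> ('a \<Rightarrow> real) \<Rightarrow> 'a \<Rightarrow> real" where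
  "scaled_regularizer K f u = real_of_ereal (ereal (f u * sqrt 2.75) / esqrt (sup_on K f))"

end

theory Submission
  imports Defs
begin

text \<open>
  The proof is primal. Write \<open>F\<^sub>t\<close> for the objective minimized by \<open>w\<^sub>t\<close>, \<open>S\<^sub>t\<close> for the sum of the
  squared dual norms of the first \<open>t\<close> losses, and \<open>M\<close> for \<open>sup f\<close>. Minimality makes a multiple of
  the cumulative loss a subgradient of \<open>f\<close> at \<open>w\<^sub>t\<close>, so \<open>F\<^sub>t\<close> grows quadratically away from \<open>w\<^sub>t\<close>.
  As the regularizers increase with \<open>t\<close>, \<open>F\<^sub>t\<^sub>+\<^sub>1(u) \<ge> F\<^sub>t(w\<^sub>t) + \<langle>\<ell>\<^sub>t, w\<^sub>t\<rangle> - \<delta>\<^sub>t\<close> on \<open>K\<close>, where \<open>\<delta>\<^sub>t\<close> is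
  bounded both by \<open>\<parallel>\<ell>\<^sub>t\<parallel>\<^sup>2 \<surd>M / \<surd>S\<^sub>t\<^sub>-\<^sub>1\<close> and by \<open>\<parallel>\<ell>\<^sub>t\<parallel>\<close> times the diameter of \<open>K\<close>, which
  is at most \<open>2 \<surd>(2M)\<close>. Together these give \<open>\<delta>\<^sub>t \<le> 5 \<surd>M (\<surd>S\<^sub>t - \<surd>S\<^sub>t\<^sub>-\<^sub>1)\<close>, which telescopes.
\<close>

section \<open>Compactness and minimizers in finite dimension\<close>

text \<open>Induction on the spanning set: a new vector \<open>b\<close> outside
  \<open>span B\<close> keeps a positive distance from it, which bounds the coefficient of
  \<open>b\<close> on a ball. The radius is arbitrary because the induction hypothesis is used at
  other radii.\<close>

lemma compact_cball_Int_span: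
  fixes B :: "'a::real_normed_vector set"
  assumes "finite B"
  shows "compact (cball 0 r \<inter> span B)"
  using assms
proof (induction B arbitrary: r rule: finite_induct)
  case empty
  have "cball 0 r \<inter> span {} = (if r < 0 then {} else {0::'a})"
    by auto
  then show ?case by simp
next
  case (insert b B)
  show ?case
  proof (cases "b \<in> span B")
    case True
    then show ?thesis using insert.IH by (simp add: span_redundant)
  next
    case False
    \<comment> \<open>Points of \<open>span B\<close> within \<open>norm b\<close> of
      \<open>b\<close> have norm at most \<open>2 * norm b\<close>, so closedness of this one
      compact piece separates \<open>b\<close> from all of \<open>span B\<close>.\<close>
    have sub: "- (cball 0 (2 * norm b) \<inter> span B) \<inter> ball b (norm b) \<subseteq> - span B"
    proof
      fix x assume x: "x \<in> - (cball 0 (2 * norm b) \<inter> span B) \<inter> ball b (norm b)"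
      have "norm x \<le> norm b + norm (x - b)"
        by (metis norm_triangle_sub)
      also have "\<dots> \<le> 2 * norm b"
        using x by (simp add: dist_norm norm_minus_commute)
      finally show "x \<in> - span B" using x by auto
    qed
    have "b \<noteq> 0" using False span_zero by auto
    have "open (- (cball 0 (2 * norm b) \<inter> span B) \<inter> ball b (norm b))"
      by (intro open_Int open_ball open_Compl compact_imp_closed insert.IH)
    moreover have "b \<in> - (cball 0 (2 * norm b) \<inter> span B) \<inter> ball b (norm b)"
      using False \<open>b \<noteq> 0\<close> by simp
    ultimately obtain d where d: "d > 0" "ball b d \<subseteq> - span B"
      using sub by (meson open_contains_ball subset_trans)
    have coeff: "\<bar>t\<bar> * d \<le> norm (y + t *\<^sub>R b)" if "y \<in> span B" for t y
    proof (cases "t = 0")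
      case False
      have "(-1 / t) *\<^sub>R y \<in> span B" using that by (rule span_scale)
      then have "(-1 / t) *\<^sub>R y \<notin> ball b d" using d(2) by blast
      then have "d \<le> norm (b - (-1 / t) *\<^sub>R y)" by (simp add: dist_norm)
      then have "\<bar>t\<bar> * d \<le> norm (t *\<^sub>R (b - (-1 / t) *\<^sub>R y))"
        by (simp add: mult_left_mono)
      also have "t *\<^sub>R (b - (-1 / t) *\<^sub>R y) = y + t *\<^sub>R b"
        using False by (simp add: algebra_simps)
      finally show ?thesis .
    qed simp
    \<comment> \<open>\<open>C\<close> bounds the coefficient of \<open>b\<close> on the ball, hence
      \<open>r + C * norm b\<close> bounds the remaining component.\<close>
    define C where "C = r / d"
    let ?P = "{-C..C} \<times> (cball 0 (r + C * norm b) \<inter> span B)"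
    let ?Q = "(\<lambda>(t, y). y + t *\<^sub>R b) ` ?P"
    have "compact ?Q"
      unfolding case_prod_unfold
      by (intro compact_continuous_image continuous_intros compact_Times compact_Icc insert.IH)
    moreover have "closed (cball 0 r :: 'a set)" by simp
    moreover have "cball 0 r \<inter> span (insert b B) = cball 0 r \<inter> ?Q"
    proof (intro equalityI subsetI)
      fix x assume x: "x \<in> cball 0 r \<inter> span (insert b B)"
      then obtain t where t: "x - t *\<^sub>R b \<in> span B"
        by (auto simp: span_insert)
      have "\<bar>t\<bar> * d \<le> r" using coeff[OF t, of t] x by simp
      then have tC: "\<bar>t\<bar> \<le> C" using d(1) by (simp add: C_def pos_le_divide_eq)
      have "norm (x - t *\<^sub>R b) \<le> norm x + \<bar>t\<bar> * norm b"
        by (metis norm_scaleR norm_triangle_ineq4)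
      also have "\<dots> \<le> r + C * norm b"
        using x tC by (intro add_mono mult_right_mono) auto
      finally have "(t, x - t *\<^sub>R b) \<in> ?P" using t tC by auto
      then have "x \<in> ?Q" by (rule rev_image_eqI) simp
      then show "x \<in> cball 0 r \<inter> ?Q" using x by blast
    next
      fix x assume x: "x \<in> cball 0 r \<inter> ?Q"
      have "span B \<subseteq> span (insert b B)" by (intro span_mono) auto
      then show "x \<in> cball 0 r \<inter> span (insert b B)"
        using x by (auto intro!: span_add span_scale intro: span_base)
    qed
    ultimately show ?thesis by (metis closed_Int_compact)
  qed
qed

lemma finite_dimensional_compact:
  fixes K :: "'a::real_normed_vector set"
  assumes "finite_dimensional TYPE('a)" "bounded K" "closed K"
  shows "compact K"
proof -
  obtain B :: "'a set" where B: "finite B" "span B = UNIV"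
    using assms(1) by (auto simp: finite_dimensional_def)
  obtain r where "K \<subseteq> cball 0 r"
    using assms(2) bounded_any_center[of K 0] by (metis mem_cball subsetI)
  then show ?thesis
    using closed_Int_compact[OF assms(3) compact_cball_Int_span[OF B(1), of r]] B(2)
    by (simp add: inf.absorb1)
qed

text \<open>Without a minimizer, every \<open>x\<close> has a point \<open>p x\<close> of smaller
  value, and \<open>f\<close> stays above \<open>f (p x)\<close> near \<open>x\<close>. Finitely
  many such neighbourhoods cover \<open>K\<close>. The least of their values \<open>f (p x)\<close>
  is undercut by that of the neighbourhood containing \<open>p x\<close>.\<close>

lemma lower_semicontinuous_on_attains_min:
  assumes "compact K" "K \<noteq> {}" "lower_semicontinuous_on K f"
  shows "\<exists>x\<in>K. \<forall>y\<in>K. f x \<le> f y"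
proof (rule ccontr)
  assume "\<not> ?thesis"
  then obtain p where p: "\<And>x. x \<in> K \<Longrightarrow> p x \<in> K \<and> f (p x) < f x"
    by (metis not_le)
  have "\<exists>U. open U \<and> x \<in> U \<and> (\<forall>y\<in>U \<inter> K. f (p x) < f y)" if x: "x \<in> K" for x
  proof -
    have "eventually (\<lambda>y. f (p x) < f y) (at x within K)"
      using assms(3) x p[OF x] by (auto simp: lower_semicontinuous_on_def)
    then obtain U where "open U" "x \<in> U" "\<forall>y\<in>U. y \<noteq> x \<longrightarrow> y \<in> K \<longrightarrow> f (p x) < f y"
      unfolding eventually_at_topological by auto
    then show ?thesis using p[OF x] by (intro exI[of _ U]) auto
  qed
  then obtain U where U: "\<And>x. x \<in> K \<Longrightarrow> open (U x) \<and> x \<in> U x \<and> (\<forall>y\<in>U x \<inter> K. f (p x) < f y)"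
    by metis
  obtain N where N: "N \<subseteq> K" "finite N" "K \<subseteq> (\<Union>x\<in>N. U x)"
    using compactE_image[OF assms(1), of K U] U by blast
  then have "N \<noteq> {}" using assms(2) by auto
  define x where "x = arg_min_on (\<lambda>x. f (p x)) N"
  have x: "x \<in> N" "\<And>z. z \<in> N \<Longrightarrow> f (p x) \<le> f (p z)"
    unfolding x_def using N(2) \<open>N \<noteq> {}\<close> by (auto intro: arg_min_if_finite arg_min_least)
  have "p x \<in> K" using p x(1) N(1) by blast
  then obtain z where z: "z \<in> N" "p x \<in> U z" using N(3) by blast
  then have "f (p z) < f (p x)" using U N(1) \<open>p x \<in> K\<close> by blast
  then show False using x(2)[OF z(1)] by simp
qed

section \<open>Consequences of strong convexity\<close>

text \<open>Zero is a subgradient at the minimizer \<open>v\<close>, so all of \<open>K\<close> lies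
  within \<open>sqrt (2 * M)\<close> of \<open>v\<close>.\<close>

lemma strongly_convex_on_diameter:
  fixes f :: "'a::real_normed_vector \<Rightarrow> real"
  assumes "strongly_convex_on 1 K f" "v \<in> K" "\<And>y. y \<in> K \<Longrightarrow> f v \<le> f y"
    and "\<And>y. y \<in> K \<Longrightarrow> 0 \<le> f y" "\<And>y. y \<in> K \<Longrightarrow> f y \<le> M" "x \<in> K" "y \<in> K"
  shows "norm (x - y) \<le> 2 * sqrt (2 * M)"
proof -
  have "0 \<in> subdifferential K f v"
    using assms(3) by (simp add: subdifferential_def)
  then have "norm (v - z) \<le> sqrt (2 * M)" if "z \<in> K" for z
    using assms(1,2) that assms(4)[of v] assms(5)[of z]
    by (force simp: strongly_convex_on_def intro: real_le_rsqrt)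
  from this[OF assms(6)] this[OF assms(7)] show ?thesis
    using norm_triangle_ineq4[of "v - y" "v - x"] by simp
qed

text \<open>For \<open>c > 0\<close>, minimality rearranges to \<open>-L / c\<close> being a
  subgradient of \<open>f\<close> at \<open>x\<close>, which is what gives strong convexity content
  there. For \<open>c = 0\<close>, as in the first round, the claim is minimality itself.\<close>

lemma ftrl_quadratic_growth:
  fixes f :: "'a::real_normed_vector \<Rightarrow> real" and L :: "'a \<Rightarrow>\<^sub>L real"
  assumes "strongly_convex_on \<mu> K f" "x \<in> K" "y \<in> K" "0 \<le> c"
    and "\<And>z. z \<in> K \<Longrightarrow> blinfun_apply L x + c * f x \<le> blinfun_apply L z + c * f z"
  shows "blinfun_apply L x + c * f x + c * \<mu> / 2 * (norm (x - y))\<^sup>2 \<le> blinfun_apply L y + c * f y"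
proof (cases "c = 0")
  case True
  then show ?thesis using assms(5)[OF assms(3)] by simp
next
  case False
  then have c: "c > 0" using assms(4) by simp
  have "(-1 / c) *\<^sub>R L \<in> subdifferential K f x"
    unfolding subdifferential_def
  proof (intro CollectI ballI)
    fix z assume "z \<in> K"
    from assms(5)[OF this] c show "f x + blinfun_apply ((-1 / c) *\<^sub>R L) (z - x) \<le> f z"
      by (simp add: scaleR_blinfun.rep_eq uminus_blinfun.rep_eq blinfun.diff_right field_simps)
  qed
  then have "f x + (-1 / c) * blinfun_apply L (y - x) + \<mu> / 2 * (norm (x - y))\<^sup>2 \<le> f y"
    using assms(1-3) unfolding strongly_convex_on_def by (metis blinfun.scaleR_left real_scaleR_def)
  then have "c * (f x + (-1 / c) * blinfun_apply L (y - x) + \<mu> / 2 * (norm (x - y))\<^sup>2) \<le> c * f y"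
    using c by (intro mult_left_mono) auto
  then show ?thesis using c by (simp add: algebra_simps blinfun.diff_right)
qed

section \<open>Regret against a fixed comparator\<close>

text \<open>Here \<open>x\<close> is the norm of the new loss, \<open>s\<close> the root of the
  earlier squared norms, \<open>r\<close> a distance in \<open>K\<close> and \<open>m\<close> the
  root of \<open>sup f\<close>. For small \<open>x\<close> the quadratic term controls the gain; for
  large \<open>x\<close> the diameter does.\<close>

lemma stability_term_le:
  fixes a m r s x :: real
  assumes "m > 0" "a \<ge> 3 / (2 * m)" "0 \<le> s" "0 \<le> x" "0 \<le> r" "r \<le> 3 * m"
  shows "x * r - a * s / 2 * r\<^sup>2 \<le> 5 * m * (sqrt (s\<^sup>2 + x\<^sup>2) - s)"
proof (cases "x \<le> 3 * s")
  case True
  define q where "q = sqrt (s\<^sup>2 + x\<^sup>2)"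
  show ?thesis
  proof (cases "s = 0")
    case True
    with \<open>x \<le> 3 * s\<close> assms show ?thesis by simp
  next
    case False
    then have s: "s > 0" using assms by simp
    have "x * r - a * s / 2 * r\<^sup>2 \<le> x * r - 3 / (2 * m) * s / 2 * r\<^sup>2"
      using assms by (intro diff_left_mono mult_right_mono divide_right_mono) auto
    also have "\<dots> \<le> m * x\<^sup>2 / (3 * s)"
    proof -
      \<comment> \<open>The concave quadratic in \<open>r\<close> peaks at
        \<open>r = 2 * m * x / (3 * s)\<close>.\<close>
      have "0 \<le> (3 * s * r - 2 * m * x)\<^sup>2" by simp
      then show ?thesis using s assms by (simp add: field_simps power2_eq_square)
    qed
    also have "\<dots> = 5 * m * (x\<^sup>2 / (15 * s))"
      by simp
    also have "\<dots> \<le> 5 * m * (q - s)"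
    proof (intro mult_left_mono)
      have q2: "q\<^sup>2 = s\<^sup>2 + x\<^sup>2" by (simp add: q_def)
      have "x\<^sup>2 \<le> (3 * s)\<^sup>2" using True assms by (intro power_mono) auto
      then have "x\<^sup>2 \<le> 9 * s\<^sup>2" by (simp add: power_mult_distrib)
      then have "s\<^sup>2 + x\<^sup>2 \<le> 16 * s\<^sup>2"
        using zero_le_power2[of s] by linarith
      then have "s\<^sup>2 + x\<^sup>2 \<le> (4 * s)\<^sup>2" by (simp add: power_mult_distrib)
      then have "q \<le> 4 * s"
        unfolding q_def using s by (intro real_le_lsqrt) auto
      have "s \<le> q" unfolding q_def by (intro real_le_rsqrt) simp
      have "x\<^sup>2 = (q - s) * (q + s)" using q2 by (simp add: algebra_simps power2_eq_square)
      also have "\<dots> \<le> (q - s) * (15 * s)"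
        using \<open>q \<le> 4 * s\<close> \<open>s \<le> q\<close> s by (intro mult_left_mono) auto
      finally show "x\<^sup>2 / (15 * s) \<le> q - s" using s by (simp add: field_simps)
    qed (use assms in auto)
    finally show ?thesis by (simp add: q_def)
  qed
next
  \<comment> \<open>Now \<open>s < x / 3\<close>, so the root grows by at least
    \<open>2 / 3 * x\<close>, more than the \<open>3 / 5 * x\<close> that
    \<open>r \<le> 3 * m\<close> calls for.\<close>
  case False
  have "0 \<le> a" using assms(1) by (intro order_trans[OF _ assms(2)]) simp
  then have "x * r - a * s / 2 * r\<^sup>2 \<le> x * r"
    using assms by simp
  also have "\<dots> \<le> x * (3 * m)" using assms by (intro mult_left_mono)
  also have "\<dots> = 5 * m * (3 / 5 * x)" by simp
  also have "\<dots> \<le> 5 * m * (sqrt (s\<^sup>2 + x\<^sup>2) - s)"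
  proof (intro mult_left_mono)
    have "x \<le> sqrt (s\<^sup>2 + x\<^sup>2)" by (intro real_le_rsqrt) simp
    then show "3 / 5 * x \<le> sqrt (s\<^sup>2 + x\<^sup>2) - s" using False assms(4) by linarith
  qed (use assms in auto)
  finally show ?thesis .
qed

lemma solo_ftrl_regret_at:
  fixes f :: "'a::real_normed_vector \<Rightarrow> real" and l :: "nat \<Rightarrow> 'a \<Rightarrow>\<^sub>L real"
  assumes ftrl: "solo_ftrl K (\<lambda>u. a * f u) l T w"
    and sc: "strongly_convex_on 1 K f" and nonneg: "\<And>v. v \<in> K \<Longrightarrow> 0 \<le> f v"
    and m: "m > 0" "a \<ge> 3 / (2 * m)"
    and diam: "\<And>x y. x \<in> K \<Longrightarrow> y \<in> K \<Longrightarrow> norm (x - y) \<le> 3 * m"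
    and u: "u \<in> K"
  shows "(\<Sum>t=1..T. blinfun_apply (l t) (w t)) - (\<Sum>t=1..T. blinfun_apply (l t) u)
           \<le> (a * f u + 5 * m) * sqrt (\<Sum>t=1..T. (norm (l t))\<^sup>2)"
proof -
  \<comment> \<open>The sums stop before round \<open>t\<close>: \<open>S t\<close> is the
    overview's \<open>S\<^sub>t\<^sub>-\<^sub>1\<close>.\<close>
  define S where "S t = (\<Sum>s=1..<t. (norm (l s))\<^sup>2)" for t
  define L where "L t = (\<Sum>s=1..<t. l s)" for t
  define F where "F t v = blinfun_apply (L t) v + a * sqrt (S t) * f v" for t v
  have a: "0 \<le> a" using m(1) by (intro order_trans[OF _ m(2)]) simp
  have S0: "0 \<le> S t" for t by (simp add: S_def sum_nonneg)
  have SSuc: "S (Suc t) = S t + (norm (l t))\<^sup>2" and LSuc: "L (Suc t) = L t + l t" if "1 \<le> t" for t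
    using that by (simp_all add: S_def L_def)
  have w: "w t \<in> K" and min: "\<And>v. v \<in> K \<Longrightarrow> F t (w t) \<le> F t v" if "t \<in> {1..T}" for t
    using ftrl that
    by (auto simp: solo_ftrl_def ftrl_def is_arg_min_linorder F_def L_def S_def mult_ac)
  have step: "F t (w t) + blinfun_apply (l t) (w t) - 5 * m * (sqrt (S (Suc t)) - sqrt (S t))
                \<le> F (Suc t) v" if t: "t \<in> {1..T}" and v: "v \<in> K" for t v
  proof -
    have "F t (w t) + a * sqrt (S t) * 1 / 2 * (norm (w t - v))\<^sup>2 \<le> F t v"
      unfolding F_def
      by (rule ftrl_quadratic_growth[OF sc w[OF t] v])
        (use a S0 min[OF t] in \<open>auto simp: F_def\<close>)
    moreover have "F t v + blinfun_apply (l t) v \<le> F (Suc t) v"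
    proof -
      have "a * sqrt (S t) * f v \<le> a * sqrt (S (Suc t)) * f v"
        using t a nonneg[OF v] by (intro mult_right_mono mult_left_mono) (auto simp: SSuc)
      then show ?thesis using t by (simp add: F_def LSuc plus_blinfun.rep_eq)
    qed
    moreover have "blinfun_apply (l t) (w t) - blinfun_apply (l t) v \<le> norm (l t) * norm (w t - v)"
      using norm_blinfun[of "l t" "w t - v"] by (simp add: blinfun.diff_right)
    moreover have "norm (l t) * norm (w t - v) - a * sqrt (S t) / 2 * (norm (w t - v))\<^sup>2
        \<le> 5 * m * (sqrt ((sqrt (S t))\<^sup>2 + (norm (l t))\<^sup>2) - sqrt (S t))"
      using m S0 diam[OF w[OF t] v] by (intro stability_term_le) auto
    ultimately show ?thesis using t S0 by (simp add: SSuc)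
  qed
  \<comment> \<open>The bound is proved for every \<open>v\<close> in \<open>K\<close> because the
    induction step evaluates it at the next prediction \<open>w (Suc n)\<close>.\<close>
  have "(\<Sum>t=1..n. blinfun_apply (l t) (w t)) - 5 * m * sqrt (S (Suc n)) \<le> F (Suc n) v"
    if "n \<le> T" "v \<in> K" for n v
    using that
  proof (induction n arbitrary: v)
    case 0
    then show ?case by (simp add: F_def L_def S_def)
  next
    case (Suc n)
    then show ?case
      using Suc.IH[OF _ w[of "Suc n"]] step[of "Suc n" v] by (simp add: algebra_simps)
  qed
  from this[OF order_refl u] show ?thesis
    by (simp add: F_def L_def S_def blinfun.sum_left atLeastLessThanSuc_atLeastAtMost algebra_simps)
qed

theorem corollary2:
  fixes K :: "'a::real_normed_vector set"
    and f :: "'a \<Rightarrow> real"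
    and l :: "nat \<Rightarrow> 'a \<Rightarrow>\<^sub>L real"
    and w :: "nat \<Rightarrow> 'a"
    and T :: nat
  assumes "finite_dimensional TYPE('a)"
    and "K \<noteq> {}" and "bounded K" and "closed K" and "convex K"
    and "\<And>v. v \<in> K \<Longrightarrow> f v \<ge> 0"
    and "lower_semicontinuous_on K f"
    and "strongly_convex_on 1 K f"
    and "solo_ftrl K (scaled_regularizer K f) l T w"
  shows "ereal (regret K l w T)
           \<le> ereal 13.3 * esqrt (sup_on K f * ereal (\<Sum>t=1..T. (norm (l t))\<^sup>2))"
proof -
  define S where "S = (\<Sum>t=1..T. (norm (l t))\<^sup>2)"
  have S0: "0 \<le> S" by (simp add: S_def sum_nonneg)
  have regret_le: "regret K l w T \<le> b"
    if "\<And>u. u \<in> K \<Longrightarrow>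
      (\<Sum>t=1..T. blinfun_apply (l t) (w t)) - (\<Sum>t=1..T. blinfun_apply (l t) u) \<le> b" for b
    unfolding regret_def using assms(2) that by (rule cSUP_least)
  obtain v where v: "v \<in> K" "\<And>y. y \<in> K \<Longrightarrow> f v \<le> f y"
    using lower_semicontinuous_on_attains_min[OF finite_dimensional_compact] assms by metis
  have fle: "ereal (f y) \<le> sup_on K f" if "y \<in> K" for y
    unfolding sup_on_def using that by (rule SUP_upper)
  have wK: "w t \<in> K" if "t \<in> {1..T}" for t
    using assms(9) that by (auto simp: solo_ftrl_def ftrl_def is_arg_min_def)
  show ?thesis
  proof (cases "sup_on K f")
    \<comment> \<open>The right-hand side is infinite unless all losses vanish; then
      \<open>\<infinity> * 0 = 0\<close> and the regret is at most 0.\<close>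
    case PInf
    show ?thesis
    proof (cases "S = 0")
      case True
      then have "l t = 0" if "t \<in> {1..T}" for t
        using that by (simp add: S_def sum_nonneg_eq_0_iff)
      then have "regret K l w T \<le> 0" by (intro regret_le) simp
      then show ?thesis using True PInf unfolding S_def[symmetric] by (simp add: esqrt_def)
    next
      case False
      then show ?thesis using S0 PInf unfolding S_def[symmetric] by (simp add: esqrt_def)
    qed
  next
    case MInf
    then show ?thesis using fle[OF v(1)] by simp
  next
    case (real M)
    have fM: "f y \<le> M" if "y \<in> K" for y
      using fle[OF that] real by simp
    have M0: "0 \<le> M" using fM[OF v(1)] assms(6)[OF v(1)] by simp
    have diam: "norm (x - y) \<le> 2 * sqrt (2 * M)" if "x \<in> K" "y \<in> K" for x y
      using strongly_convex_on_diameter[OF assms(8) v assms(6) fM that] by simp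
    have "regret K l w T \<le> 13.3 * sqrt (M * S)"
    proof (cases "M = 0")
      \<comment> \<open>The diameter bound makes \<open>K\<close> a single point.\<close>
      case True
      then have "w t = u" if "t \<in> {1..T}" "u \<in> K" for t u
        using diam[OF wK that(2)] that(1) by simp
      then have "regret K l w T \<le> 0" by (intro regret_le) simp
      then show ?thesis using True by simp
    next
      case False
      define a where "a = sqrt 2.75 / sqrt M"
      have m: "sqrt M > 0" using False M0 by simp
      have "scaled_regularizer K f = (\<lambda>u. a * f u)"
        using m by (simp add: fun_eq_iff scaled_regularizer_def real esqrt_def a_def)
      then have ftrl: "solo_ftrl K (\<lambda>u. a * f u) l T w" using assms(9) by simp
      have "3 / 2 \<le> sqrt 2.75" by (intro real_le_rsqrt) (simp add: power2_eq_square)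
      then have a: "a \<ge> 3 / (2 * sqrt M)" using m by (simp add: a_def field_simps)
      have "sqrt 2 \<le> 3 / 2" by (intro real_le_lsqrt) (auto simp: power2_eq_square)
      have diam': "norm (x - y) \<le> 3 * sqrt M" if "x \<in> K" "y \<in> K" for x y
        using diam[OF that] mult_right_mono[OF \<open>sqrt 2 \<le> 3 / 2\<close> less_imp_le[OF m]]
        by (simp add: real_sqrt_mult)
      show ?thesis
      proof (rule regret_le)
        fix u assume u: "u \<in> K"
        have "a * f u \<le> a * M"
          using a m fM[OF u] by (intro mult_left_mono) (auto simp: a_def)
        also have "\<dots> = sqrt 2.75 * sqrt M"
          using M0 m by (simp add: a_def field_simps)
        also have "\<dots> \<le> 2 * sqrt M"
          using m by (intro mult_right_mono real_le_lsqrt) auto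
        \<comment> \<open>The constant obtained is 2 + 5 = 7, well below 13.3.\<close>
        finally have "a * f u + 5 * sqrt M \<le> 13.3 * sqrt M" using m by linarith
        then have "(a * f u + 5 * sqrt M) * sqrt S \<le> 13.3 * sqrt M * sqrt S"
          using S0 by (intro mult_right_mono) auto
        with solo_ftrl_regret_at[OF ftrl assms(8) assms(6) m a diam' u]
        show "(\<Sum>t=1..T. blinfun_apply (l t) (w t)) - (\<Sum>t=1..T. blinfun_apply (l t) u)
                \<le> 13.3 * sqrt (M * S)"
          by (simp add: S_def real_sqrt_mult)
      qed
    qed
    then show ?thesis using real unfolding S_def[symmetric] by (simp add: esqrt_def)
  qed
qed

end
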